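(* Let $\pi$ be a service policy for a single-station, single-customer-class queueing system with reneging such that the customer arrival times to this system do not have a finite accumulation point. Let $R_\pi(t)$ be the amount of work removed from this system up to time $t$ due to lateness. Let $R_W(t)$ be the amount of work removed due to lateness up to time $t$ from the EDF (earliest-deadline-first) system with reneging and the same interarrival times, service times and lead times as in the former system. Then for every $t\ge0$, $R_W(t)\le R_\pi(t)$.
   Context: The statement is pathwise (deterministic). A system is specified by arrival times $S_k$, service times $v_k>0$ and initial lead times $L_k>0$, $k\ge1$; it is empty at time $0$. Customer $k$ arrives at time $S_k$ requiring $v_k$ units of work, and has deadline $d_k=S_k+L_k$. A service policy specifies at each time which customer present (if any) is being served; the server works at unit rate on the customer in service, serves at most one customer at a time, may preempt (interrupted service is later resumed without loss), and may idle even when customers are present. A customer leaves the system when its service is completed; with reneging, a customer still present when its deadline passes leaves at time $d_k$, and its residual service time just before $d_k$ is the work removed due to lateness at that time. $R_\pi(t)$ is the sum of these removed residual service times over all customers with $d_k\le t$. The EDF policy is work-conserving (the server never idles when customers are present) and preemptive-resume, always serving the present customer with the smallest lead time, i.e. the earliest deadline. *)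

theory Defs
  imports "HOL-Analysis.Analysis"
begin

text \<open>Customers are indexed by \<^typ>\<open>nat\<close> (starting at 0). Customer \<open>k\<close> has arrival
  time \<open>S k\<close>, service time \<open>v k\<close> and initial lead time \<open>L k\<close>.\<close>

text \<open>Accumulation points are those of the sequence, not of its range, so infinitely many
  arrivals at one and the same time also count as accumulation.\<close>

definition seq_accumulation_point :: "(nat \<Rightarrow> real) \<Rightarrow> real \<Rightarrow> bool" where
  "seq_accumulation_point S x \<longleftrightarrow> (\<forall>e>0. infinite {k. dist (S k) x < e})"

definition deadline :: "(nat \<Rightarrow> real) \<Rightarrow> (nat \<Rightarrow> real) \<Rightarrow> nat \<Rightarrow> real" where
  "deadline S L k = S k + L k"

text \<open>The action of a policy along the given path is a function \<open>\<pi>\<close>: at time \<open>s \<ge> 0\<close> the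
  server works on customer \<open>k\<close> if \<open>\<pi> s = Some k\<close> and idles if \<open>\<pi> s = None\<close>. As the server works
  at unit rate, the work done on \<open>k\<close> before \<open>t\<close> is the Lebesgue measure of the time spent on \<open>k\<close>;
  interrupted service is resumed without loss because this quantity accumulates.\<close>

definition work_done :: "(real \<Rightarrow> nat option) \<Rightarrow> nat \<Rightarrow> real \<Rightarrow> real" where
  "work_done \<pi> k t = measure lebesgue {s \<in> {0..<t}. \<pi> s = Some k}"

definition residual_service ::
  "(nat \<Rightarrow> real) \<Rightarrow> (real \<Rightarrow> nat option) \<Rightarrow> nat \<Rightarrow> real \<Rightarrow> real" where
  "residual_service v \<pi> k t = v k - work_done \<pi> k t"

text \<open>A customer leaves when its service is completed or when its deadline passes, so it is no
  longer present at the departure time itself.\<close>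

definition present ::
  "(nat \<Rightarrow> real) \<Rightarrow> (nat \<Rightarrow> real) \<Rightarrow> (nat \<Rightarrow> real) \<Rightarrow> (real \<Rightarrow> nat option) \<Rightarrow> nat \<Rightarrow> real \<Rightarrow> bool" where
  "present S v L \<pi> k t \<longleftrightarrow>
     S k \<le> t \<and> t < deadline S L k \<and> 0 < residual_service v \<pi> k t"

definition service_policy ::
  "(nat \<Rightarrow> real) \<Rightarrow> (nat \<Rightarrow> real) \<Rightarrow> (nat \<Rightarrow> real) \<Rightarrow> (real \<Rightarrow> nat option) \<Rightarrow> bool" where
  "service_policy S v L \<pi> \<longleftrightarrow>
     (\<forall>k. {s \<in> {0..}. \<pi> s = Some k} \<in> sets lebesgue) \<and>
     (\<forall>t\<ge>0. \<forall>k. \<pi> t = Some k \<longrightarrow> present S v L \<pi> k t)"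

definition work_conserving ::
  "(nat \<Rightarrow> real) \<Rightarrow> (nat \<Rightarrow> real) \<Rightarrow> (nat \<Rightarrow> real) \<Rightarrow> (real \<Rightarrow> nat option) \<Rightarrow> bool" where
  "work_conserving S v L \<pi> \<longleftrightarrow>
     (\<forall>t\<ge>0. (\<exists>k. present S v L \<pi> k t) \<longrightarrow> \<pi> t \<noteq> None)"

text \<open>The lead time of \<open>k\<close> at time \<open>t\<close> is \<open>deadline S L k - t\<close>, so the smallest lead time is the
  earliest deadline. Ties between equal deadlines may be broken arbitrarily.\<close>

definition EDF_policy ::
  "(nat \<Rightarrow> real) \<Rightarrow> (nat \<Rightarrow> real) \<Rightarrow> (nat \<Rightarrow> real) \<Rightarrow> (real \<Rightarrow> nat option) \<Rightarrow> bool" where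
  "EDF_policy S v L \<pi> \<longleftrightarrow>
     service_policy S v L \<pi> \<and> work_conserving S v L \<pi> \<and>
     (\<forall>t\<ge>0. \<forall>k j. \<pi> t = Some k \<and> present S v L \<pi> j t \<longrightarrow> deadline S L k \<le> deadline S L j)"

text \<open>The residual service time at \<open>d\<close> only involves the work done on \<open>[0, d)\<close>, so it is
  the residual service time just before \<open>d\<close>.\<close>

definition reneged_work ::
  "(nat \<Rightarrow> real) \<Rightarrow> (nat \<Rightarrow> real) \<Rightarrow> (nat \<Rightarrow> real) \<Rightarrow> (real \<Rightarrow> nat option) \<Rightarrow> real \<Rightarrow> real" where
  "reneged_work S v L \<pi> t =
     (\<Sum>k | deadline S L k \<le> t \<and> 0 < residual_service v \<pi> k (deadline S L k).
        residual_service v \<pi> k (deadline S L k))"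

end

theory Submission imports Defs begin

text \<open>The proof is a min-cut argument. For a customer \<open>k\<close> that reneges under EDF, go back from its
  deadline \<open>d\<^sub>k\<close> to the earliest arrival time \<open>\<tau>\<^sub>k\<close> such that EDF serves only deadlines \<open>\<le> d\<^sub>k\<close>
  throughout \<open>[\<tau>\<^sub>k, d\<^sub>k)\<close>. Every customer served in that interval also arrived in it. Let \<open>T\<close> be the
  union of these intervals and \<open>A\<close> the set of customers whose whole window \<open>[S\<^sub>j, d\<^sub>j)\<close> lies in one
  of them. No policy does more work on \<open>A\<close> than the length of \<open>T\<close>, EDF attains this bound, and EDF
  completes every customer outside \<open>A\<close>.\<close>

text \<open>By compactness: every point has a neighbourhood that catches \<open>S k\<close> for only
  finitely many indices \<open>k\<close>, and finitely many of these cover \<open>{0..t}\<close>,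
  where nonnegativity traps all arrivals up to \<open>t\<close>.\<close>

lemma finite_arrivals_before:
  fixes S :: "nat \<Rightarrow> real"
  assumes nonneg: "\<And>k. 0 \<le> S k" and no_acc: "\<nexists>x. seq_accumulation_point S x"
  shows "finite {k. S k \<le> t}"
proof -
  have "\<forall>x. \<exists>e>0. finite {k. dist (S k) x < e}"
    using no_acc by (auto simp: seq_accumulation_point_def)
  then obtain e where e: "\<And>x. 0 < e x" "\<And>x. finite {k. dist (S k) x < e x}"
    by metis
  obtain C where C: "C \<subseteq> {0..t}" "finite C" "{0..t} \<subseteq> (\<Union>x\<in>C. ball x (e x))"
  proof (rule compactE_image)
    show "compact {0..t}" by simp
    show "{0..t} \<subseteq> (\<Union>x\<in>{0..t}. ball x (e x))"
      using e(1) by force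
  qed auto
  have "{k. S k \<le> t} \<subseteq> (\<Union>x\<in>C. {k. dist (S k) x < e x})"
  proof
    fix k assume "k \<in> {k. S k \<le> t}"
    then have "S k \<in> {0..t}" using nonneg by simp
    then show "k \<in> (\<Union>x\<in>C. {k. dist (S k) x < e x})"
      using C(3) by (force simp: dist_commute)
  qed
  then show ?thesis
    using C(2) e(2) by (meson finite_UN_I finite_subset)
qed

lemma lmeasurable_atLeastLessThan: "{a..<b::real} \<in> lmeasurable"
  by (rule bounded_set_imp_lmeasurable) auto

lemma service_times_lmeasurable:
  assumes "service_policy S v L \<pi>"
  shows "{s \<in> {0..<t}. \<pi> s = Some k} \<in> lmeasurable"
proof -
  have "{s \<in> {0..}. \<pi> s = Some k} \<in> sets lebesgue"
    using assms by (simp add: service_policy_def)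
  then have "{0..<t} \<inter> {s \<in> {0..}. \<pi> s = Some k} \<in> lmeasurable"
    by (intro fmeasurable_Int_fmeasurable lmeasurable_atLeastLessThan)
  moreover have "{0..<t} \<inter> {s \<in> {0..}. \<pi> s = Some k} = {s \<in> {0..<t}. \<pi> s = Some k}"
    by auto
  ultimately show ?thesis by simp
qed

lemma work_done_mono:
  assumes "service_policy S v L \<pi>" "s \<le> t"
  shows "work_done \<pi> k s \<le> work_done \<pi> k t"
  unfolding work_done_def
  using assms service_times_lmeasurable[OF assms(1)]
  by (intro measure_mono_fmeasurable fmeasurableD) auto

text \<open>Work done only grows with time, so work still missing at \<open>s\<close> was missing at
  every earlier time too.\<close>

lemma present_before:
  assumes pol: "service_policy S v L \<pi>"
    and "0 < residual_service v \<pi> k s" "S k \<le> u" "u \<le> s" "u < deadline S L k"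
  shows "present S v L \<pi> k u"
  using assms work_done_mono[OF pol \<open>u \<le> s\<close>, of k]
  by (simp add: present_def residual_service_def)

text \<open>Up to any time at which \<open>k\<close> is served, the work done on \<open>k\<close> is below \<open>v k\<close>; letting that
  time approach the supremum of the service times gives the bound.\<close>

lemma work_done_le_service:
  assumes pol: "service_policy S v L \<pi>" and "0 < v k"
  shows "work_done \<pi> k t \<le> v k"
proof -
  define X where "X = {s \<in> {0..<t}. \<pi> s = Some k}"
  show ?thesis
  proof (cases "X = {}")
    case True
    then show ?thesis
      using \<open>0 < v k\<close> unfolding work_done_def X_def[symmetric] by simp
  next
    case False
    have bdd: "bdd_above X" unfolding X_def by (rule bdd_aboveI[of _ t]) auto
    show ?thesis
    proof (rule field_le_epsilon)
      fix \<epsilon> :: real assume "0 < \<epsilon>"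
      then obtain s where s: "s \<in> X" "Sup X - \<epsilon> < s"
        using less_cSup_iff[OF False bdd, of "Sup X - \<epsilon>"] by auto
      then have "s \<le> Sup X" using bdd by (intro cSup_upper)
      have lm: "{u \<in> {0..<s}. \<pi> u = Some k} \<in> lmeasurable"
        by (rule service_times_lmeasurable[OF pol])
      have "X \<subseteq> {u \<in> {0..<s}. \<pi> u = Some k} \<union> {s..Sup X}"
        using cSup_upper[OF _ bdd] by (auto simp: X_def not_less)
      then have "measure lebesgue X \<le> measure lebesgue ({u \<in> {0..<s}. \<pi> u = Some k} \<union> {s..Sup X})"
        using lm service_times_lmeasurable[OF pol, of t k]
        by (intro measure_mono_fmeasurable fmeasurableD fmeasurable.Un) (auto simp: X_def)
      also have "\<dots> \<le> work_done \<pi> k s + measure lebesgue {s..Sup X}"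
        unfolding work_done_def by (intro measure_Un_le fmeasurableD lm) auto
      also have "\<dots> \<le> v k + \<epsilon>"
        using s \<open>s \<le> Sup X\<close> pol
        by (force simp: X_def service_policy_def present_def residual_service_def)
      finally show "work_done \<pi> k t \<le> v k + \<epsilon>"
        by (simp add: work_done_def X_def)
    qed
  qed
qed

text \<open>A single server makes the service times of distinct customers disjoint, so total work
  becomes the measure of one set of times and can be compared by inclusion.\<close>

lemma work_on_set:
  assumes pol: "service_policy S v L \<pi>" and "finite A"
  shows "(\<Union>j\<in>A. {s \<in> {0..<d j}. \<pi> s = Some j}) \<in> lmeasurable"
    and "(\<Sum>j\<in>A. work_done \<pi> j (d j)) = measure lebesgue (\<Union>j\<in>A. {s \<in> {0..<d j}. \<pi> s = Some j})"
proof -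
  show lm: "(\<Union>j\<in>A. {s \<in> {0..<d j}. \<pi> s = Some j}) \<in> lmeasurable"
    using assms by (intro fmeasurable.finite_UN service_times_lmeasurable[OF pol]) auto
  show "(\<Sum>j\<in>A. work_done \<pi> j (d j)) = measure lebesgue (\<Union>j\<in>A. {s \<in> {0..<d j}. \<pi> s = Some j})"
    unfolding work_done_def
    using \<open>finite A\<close> service_times_lmeasurable[OF pol]
    by (intro measure_UNION'[symmetric])
       (auto simp: pairwise_def disjnt_def)
qed

lemma EDF_busy_interval:
  assumes nonneg: "\<And>k. 0 \<le> S k" and fin: "\<And>t. finite {k. S k \<le> t}"
    and EDF: "EDF_policy S v L \<pi>"
    and late: "0 < residual_service v \<pi> k (deadline S L k)"
  obtains \<tau> where "0 \<le> \<tau>" "\<tau> \<le> S k"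
    "\<And>u. \<tau> \<le> u \<Longrightarrow> u < deadline S L k \<Longrightarrow>
       \<exists>m. \<pi> u = Some m \<and> deadline S L m \<le> deadline S L k \<and> \<tau> \<le> S m"
proof -
  let ?d = "deadline S L"
  have pol: "service_policy S v L \<pi>" using EDF by (simp add: EDF_policy_def)
  have serves: "\<exists>m. \<pi> u = Some m \<and> ?d m \<le> ?d j" if "present S v L \<pi> j u" "0 \<le> u" for j u
    using EDF that unfolding EDF_policy_def work_conserving_def by (metis not_Some_eq)
  \<comment> \<open>\<open>P i\<close> says that \<open>S i\<close> is an admissible left end of the
    busy interval. Only arrival times are candidates, so the earliest one is a minimum over a finite
    set.\<close>
  define P where "P i \<longleftrightarrow> (\<forall>u. S i \<le> u \<and> u < ?d k \<longrightarrow> (\<exists>m. \<pi> u = Some m \<and> ?d m \<le> ?d k))" for i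
  \<comment> \<open>As \<open>k\<close> is unfinished at its deadline, it is present from its
    arrival until then, and EDF must serve it or a customer that is at least as urgent.\<close>
  have "P k"
    unfolding P_def
  proof (intro allI impI)
    fix u assume u: "S k \<le> u \<and> u < ?d k"
    then have "present S v L \<pi> k u"
      using present_before[OF pol late] by auto
    then show "\<exists>m. \<pi> u = Some m \<and> ?d m \<le> ?d k"
      using serves u nonneg order_trans by blast
  qed
  have fin_early: "finite {i. S i \<le> S k \<and> P i}"
    by (rule finite_subset[OF _ fin[of "S k"]]) auto
  obtain i where i: "S i \<le> S k" "P i" and min: "\<And>j. S j \<le> S k \<Longrightarrow> P j \<Longrightarrow> S i \<le> S j"
  proof -
    let ?I = "{i. S i \<le> S k \<and> P i}"
    have "?I \<noteq> {}" using \<open>P k\<close> by auto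
    then show ?thesis
      using that[of "arg_min_on S ?I"] arg_min_if_finite[OF fin_early, of S]
        arg_min_least[OF fin_early, of _ S] by auto
  qed
  show ?thesis
  proof (rule that[of "S i"])
    fix u assume u: "S i \<le> u" "u < ?d k"
    then obtain m where m: "\<pi> u = Some m" "?d m \<le> ?d k"
      using i(2) by (auto simp: P_def)
    have "0 \<le> u" using u(1) nonneg[of i] by linarith
    then have pm: "present S v L \<pi> m u"
      using pol m(1) by (simp add: service_policy_def)
    \<comment> \<open>The arrival of the served customer is admissible as well: up to
      \<open>u\<close> the presence of \<open>m\<close> forces deadlines \<le> \<open>?d m\<close>,
      and after \<open>u\<close> the property \<open>P i\<close> takes over. Minimality of
      \<open>S i\<close> then excludes an arrival of \<open>m\<close> before
      \<open>S i\<close>.\<close>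
    have "P m"
      unfolding P_def
    proof (intro allI impI)
      fix w assume w: "S m \<le> w \<and> w < ?d k"
      show "\<exists>l. \<pi> w = Some l \<and> ?d l \<le> ?d k"
      proof (cases "w \<le> u")
        case True
        then have "present S v L \<pi> m w"
          using pm w by (intro present_before[OF pol]) (auto simp: present_def)
        then show ?thesis
          using serves w nonneg m(2) order_trans by meson
      next
        case False
        then show ?thesis using i(2) u(1) w unfolding P_def by auto
      qed
    qed
    then have "S i \<le> S m"
      using min i(1) by (cases "S m \<le> S k") auto
    then show "\<exists>m. \<pi> u = Some m \<and> ?d m \<le> ?d k \<and> S i \<le> S m"
      using m by blast
  qed (use nonneg i in auto)
qed

text \<open>This isolates what the comparison needs of EDF. \<open>T\<close> is squeezed between the
  windows of \<open>A\<close>, outside which no policy can serve \<open>A\<close>, and the times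
  that EDF spends on \<open>A\<close>.\<close>

lemma EDF_cut:
  assumes nonneg: "\<And>k. 0 \<le> S k" and fin: "\<And>t. finite {k. S k \<le> t}"
    and EDF: "EDF_policy S v L \<pi>"
    and K: "finite {k. deadline S L k \<le> t}"
  obtains A T where "A \<subseteq> {k. deadline S L k \<le> t}" "T \<in> lmeasurable"
    "\<And>k. deadline S L k \<le> t \<Longrightarrow> 0 < residual_service v \<pi> k (deadline S L k) \<Longrightarrow> k \<in> A"
    "\<And>j. j \<in> A \<Longrightarrow> {S j..<deadline S L j} \<subseteq> T"
    "T \<subseteq> (\<Union>j\<in>A. {s \<in> {0..<deadline S L j}. \<pi> s = Some j})"
proof -
  let ?d = "deadline S L"
  define B where "B = {k. ?d k \<le> t \<and> 0 < residual_service v \<pi> k (?d k)}"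
  have "finite B" by (rule finite_subset[OF _ K]) (auto simp: B_def)
  have "\<forall>k\<in>B. \<exists>\<tau>. 0 \<le> \<tau> \<and> \<tau> \<le> S k \<and> (\<forall>u. \<tau> \<le> u \<and> u < ?d k \<longrightarrow>
      (\<exists>m. \<pi> u = Some m \<and> ?d m \<le> ?d k \<and> \<tau> \<le> S m))"
  proof
    fix k assume "k \<in> B"
    then have "0 < residual_service v \<pi> k (?d k)" by (simp add: B_def)
    from EDF_busy_interval[OF nonneg fin EDF this]
    show "\<exists>\<tau>. 0 \<le> \<tau> \<and> \<tau> \<le> S k \<and> (\<forall>u. \<tau> \<le> u \<and> u < ?d k \<longrightarrow>
      (\<exists>m. \<pi> u = Some m \<and> ?d m \<le> ?d k \<and> \<tau> \<le> S m))" by metis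
  qed
  then obtain \<tau> where \<tau>: "\<And>k. k \<in> B \<Longrightarrow> 0 \<le> \<tau> k" "\<And>k. k \<in> B \<Longrightarrow> \<tau> k \<le> S k"
    and busy: "\<And>k u. k \<in> B \<Longrightarrow> \<tau> k \<le> u \<Longrightarrow> u < ?d k \<Longrightarrow>
      \<exists>m. \<pi> u = Some m \<and> ?d m \<le> ?d k \<and> \<tau> k \<le> S m"
    by metis
  \<comment> \<open>Membership looks only at arrivals and deadlines, not at whether EDF serves or
    finishes \<open>j\<close>. Late customers belong to \<open>A\<close> with themselves as witness,
    since \<open>\<tau> k\<close> \<le> \<open>S k\<close>.\<close>
  define A where "A = {j. \<exists>k\<in>B. \<tau> k \<le> S j \<and> ?d j \<le> ?d k}"
  define T where "T = (\<Union>k\<in>B. {\<tau> k..<?d k})"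
  show ?thesis
  proof (rule that[of A T])
    show "A \<subseteq> {k. ?d k \<le> t}" by (auto simp: A_def B_def)
    show "T \<in> lmeasurable"
      unfolding T_def using \<open>finite B\<close> by (intro fmeasurable.finite_UN lmeasurable_atLeastLessThan)
    show "k \<in> A" if "?d k \<le> t" "0 < residual_service v \<pi> k (?d k)" for k
      using that \<tau>(2)[of k] by (auto simp: A_def B_def)
    show "{S j..<?d j} \<subseteq> T" if "j \<in> A" for j
    proof -
      obtain k where "k \<in> B" "\<tau> k \<le> S j" "?d j \<le> ?d k"
        using \<open>j \<in> A\<close> by (auto simp: A_def)
      then have "{S j..<?d j} \<subseteq> {\<tau> k..<?d k}" by auto
      then show ?thesis using \<open>k \<in> B\<close> by (auto simp: T_def)
    qed
    show "T \<subseteq> (\<Union>j\<in>A. {s \<in> {0..<?d j}. \<pi> s = Some j})"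
    proof
      fix u assume "u \<in> T"
      then obtain k where k: "k \<in> B" "\<tau> k \<le> u" "u < ?d k" by (auto simp: T_def)
      then obtain m where m: "\<pi> u = Some m" "?d m \<le> ?d k" "\<tau> k \<le> S m"
        using busy by blast
      have "0 \<le> u" using k \<tau>(1) by force
      then have "u < ?d m"
        using EDF m(1) by (auto simp: EDF_policy_def service_policy_def present_def)
      then show "u \<in> (\<Union>j\<in>A. {s \<in> {0..<?d j}. \<pi> s = Some j})"
        using k(1) m \<open>0 \<le> u\<close> by (auto simp: A_def)
    qed
  qed
qed

text \<open>Positive parts replace the policy-dependent set of late customers by one index set
  shared by both policies.\<close>

lemma reneged_work_eq:
  assumes "finite {k. deadline S L k \<le> t}"
  shows "reneged_work S v L \<pi> t =
    (\<Sum>k | deadline S L k \<le> t. max 0 (residual_service v \<pi> k (deadline S L k)))"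
  unfolding reneged_work_def using assms
  by (intro sum.mono_neutral_cong_left) auto

theorem theorem5p1:
  fixes S v L :: "nat \<Rightarrow> real" and \<pi> \<pi>_EDF :: "real \<Rightarrow> nat option" and t :: real
  assumes arrival_nonneg: "\<And>k. 0 \<le> S k"
    and service_pos: "\<And>k. 0 < v k"
    and lead_pos: "\<And>k. 0 < L k"
    and no_accumulation: "\<nexists>x. seq_accumulation_point S x"
    and policy: "service_policy S v L \<pi>"
    and EDF: "EDF_policy S v L \<pi>_EDF"
    and "0 \<le> t"
  shows "reneged_work S v L \<pi>_EDF t \<le> reneged_work S v L \<pi> t"
proof -
  let ?d = "deadline S L"
  let ?K = "{k. ?d k \<le> t}"
  have policy_EDF: "service_policy S v L \<pi>_EDF" using EDF by (simp add: EDF_policy_def)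
  have fin: "finite {k. S k \<le> u}" for u
    using finite_arrivals_before[OF arrival_nonneg no_accumulation] .
  have "S k \<le> ?d k" for k using lead_pos[of k] by (simp add: deadline_def)
  then have "?K \<subseteq> {k. S k \<le> t}" using order_trans by blast
  then have K: "finite ?K" using fin finite_subset by blast
  obtain A T where A: "A \<subseteq> ?K" and T: "T \<in> lmeasurable"
    and late: "\<And>k. ?d k \<le> t \<Longrightarrow> 0 < residual_service v \<pi>_EDF k (?d k) \<Longrightarrow> k \<in> A"
    and window: "\<And>j. j \<in> A \<Longrightarrow> {S j..<?d j} \<subseteq> T"
    and busy: "T \<subseteq> (\<Union>j\<in>A. {s \<in> {0..<?d j}. \<pi>_EDF s = Some j})"
    by (rule EDF_cut[OF arrival_nonneg fin EDF K]) (rule that)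
  have "finite A" using A K finite_subset by blast
  \<comment> \<open>Any policy serves a customer only while it is present, hence inside its
    window.\<close>
  have "(\<Union>j\<in>A. {s \<in> {0..<?d j}. \<pi> s = Some j}) \<subseteq> T"
    using window policy by (fastforce simp: service_policy_def present_def)
  then have "(\<Sum>j\<in>A. work_done \<pi> j (?d j)) \<le> measure lebesgue T"
    using work_on_set[OF policy \<open>finite A\<close>, of ?d] T
    by (simp add: measure_mono_fmeasurable fmeasurableD)
  also have "\<dots> \<le> (\<Sum>j\<in>A. work_done \<pi>_EDF j (?d j))"
    using work_on_set[OF policy_EDF \<open>finite A\<close>, of ?d] T busy
    by (simp add: measure_mono_fmeasurable fmeasurableD)
  finally have more_work: "(\<Sum>j\<in>A. work_done \<pi> j (?d j)) \<le> (\<Sum>j\<in>A. work_done \<pi>_EDF j (?d j))" .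
  have completed: "residual_service v \<pi>_EDF k (?d k) \<le> 0" if "k \<in> ?K - A" for k
    using late[of k] that by force
  have "reneged_work S v L \<pi>_EDF t = (\<Sum>j\<in>A. max 0 (residual_service v \<pi>_EDF j (?d j)))"
    unfolding reneged_work_eq[OF K] using K A completed
    by (intro sum.mono_neutral_right) auto
  also have "\<dots> = (\<Sum>j\<in>A. residual_service v \<pi>_EDF j (?d j))"
    using work_done_le_service[where v = v, OF policy_EDF service_pos]
    by (intro sum.cong) (auto simp: residual_service_def)
  \<comment> \<open>The total service requirement of \<open>A\<close> is the same on both sides, so
    more work done means less work left.\<close>
  also have "\<dots> \<le> (\<Sum>j\<in>A. residual_service v \<pi> j (?d j))"
    using more_work by (simp add: residual_service_def sum_subtractf)
  also have "\<dots> \<le> (\<Sum>j\<in>A. max 0 (residual_service v \<pi> j (?d j)))"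
    by (intro sum_mono) simp
  also have "\<dots> \<le> reneged_work S v L \<pi> t"
    unfolding reneged_work_eq[OF K] using K A by (intro sum_mono2) auto
  finally show ?thesis .
qed

end
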